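(* Let $$f(x)=\sum_{\ell=1}^{r}a_\ell x^{\alpha_\ell},\qquad x>0,$$ have nonzero amplitudes $a_\ell\in\mathbb C$ and pairwise distinct exponents $\alpha_\ell\in\mathbb C$. Choose two scales $q_1,q_2\in(0,1)$ and collect $2r$ consecutive samples of $f$ on each of the two geometric grids $\{x_0q_j^n\}_{n\ge0}$, $j=1,2$, with the same base point $x_0>0$. Assume that (i) the nodes $q_j^{\alpha_1},\dots,q_j^{\alpha_r}$ are pairwise distinct for each $j=1,2$; (ii) $\log q_1/\log q_2\notin\mathbb Q$; (iii) either the effective weights $w_\ell=a_\ell x_0^{\alpha_\ell}$, $\ell=1,\dots,r$, are pairwise distinct, or there is an admissible set $\Omega\subset\mathbb C$ containing the exponents $\alpha_1,\dots,\alpha_r$ for which the matching-gap condition holds. Then the representation $f(x)=\sum_{\ell=1}^{r}a_\ell x^{\alpha_\ell}$ is uniquely determined by the two data sets, up to permutation of its components. Its minimal model order is $r$, and all $\alpha_\ell$ and $a_\ell$ are uniquely determined.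
   Context: For $x>0$ and $\alpha\in\mathbb C$, $x^\alpha=e^{\alpha\log x}$ with $\log x$ real. Put $h_j=\log q_j$ and $\rho_{\ell,j}=q_j^{\alpha_\ell}=e^{h_j\alpha_\ell}$. The samples on the $j$-th grid are values $f(x_0q_j^n)=\sum_{\ell=1}^{r}w_\ell\rho_{\ell,j}^n$, where the effective weights $w_\ell=a_\ell x_0^{\alpha_\ell}$ do not depend on $j$. For a set $\Omega\subset\mathbb C$ (the admissible set of exponents) and $z_1,z_2\in\mathbb C$, the compatibility cost is $$d_\Omega(z_1,z_2)=\inf_{\alpha\in\Omega}\left(|e^{h_1\alpha}-z_1|^2+|e^{h_2\alpha}-z_2|^2\right)^{1/2}.$$ Matching-gap condition for $\Omega$: there exists $\gamma>0$ such that every true pair has zero compatibility cost, i.e. $d_\Omega(\rho_{k,1},\rho_{k,2})=0$ for all $k$, while every false pair satisfies $d_\Omega(\rho_{k,1},\rho_{\ell,2})\ge\gamma$ for all $k\neq\ell$. *)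

theory Defs
  imports "HOL-Analysis.Analysis" "HOL-Combinatorics.Permutations"
begin

(* For x > 0, "of_real x powr \<alpha>" is exp (\<alpha> * of_real (ln x)). *)
definition power_sum :: "nat \<Rightarrow> (nat \<Rightarrow> complex) \<Rightarrow> (nat \<Rightarrow> complex) \<Rightarrow> real \<Rightarrow> complex" where
  "power_sum r a \<alpha> x = (\<Sum>l=1..r. a l * of_real x powr \<alpha> l)"

definition effective_weight :: "(nat \<Rightarrow> complex) \<Rightarrow> (nat \<Rightarrow> complex) \<Rightarrow> real \<Rightarrow> nat \<Rightarrow> complex" where
  "effective_weight a \<alpha> x0 l = a l * of_real x0 powr \<alpha> l"

definition node :: "(nat \<Rightarrow> complex) \<Rightarrow> real \<Rightarrow> nat \<Rightarrow> complex" where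
  "node \<alpha> q l = of_real q powr \<alpha> l"

(* m consecutive samples on the grid x0 * q ^ n, starting at n = N *)
definition samples :: "(real \<Rightarrow> complex) \<Rightarrow> real \<Rightarrow> real \<Rightarrow> nat \<Rightarrow> nat \<Rightarrow> complex list" where
  "samples f x0 q N m = map (\<lambda>n. f (x0 * q ^ n)) [N..<N + m]"

(* A real infimum, meaningful only for nonempty \<Omega>. *)
definition compat_cost :: "real \<Rightarrow> real \<Rightarrow> complex set \<Rightarrow> complex \<Rightarrow> complex \<Rightarrow> real" where
  "compat_cost q1 q2 \<Omega> z1 z2 =
     (INF \<alpha>\<in>\<Omega>. sqrt ((cmod (exp (of_real (ln q1) * \<alpha>) - z1))\<^sup>2
                     + (cmod (exp (of_real (ln q2) * \<alpha>) - z2))\<^sup>2))"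

definition matching_gap :: "real \<Rightarrow> real \<Rightarrow> nat \<Rightarrow> (nat \<Rightarrow> complex) \<Rightarrow> complex set \<Rightarrow> bool" where
  "matching_gap q1 q2 r \<alpha> \<Omega> \<longleftrightarrow>
     (\<exists>\<gamma>>0.
        (\<forall>k\<in>{1..r}. compat_cost q1 q2 \<Omega> (node \<alpha> q1 k) (node \<alpha> q2 k) = 0) \<and>
        (\<forall>k\<in>{1..r}. \<forall>l\<in>{1..r}. k \<noteq> l \<longrightarrow>
            \<gamma> \<le> compat_cost q1 q2 \<Omega> (node \<alpha> q1 k) (node \<alpha> q2 l)))"

(* A power sum of order s in reduced form (no vanishing amplitude, no repeated
   exponent) with admissible exponents; no prior constraint if \<Omega> = UNIV. *)
definition admissible_model ::
    "complex set \<Rightarrow> nat \<Rightarrow> (nat \<Rightarrow> complex) \<Rightarrow> (nat \<Rightarrow> complex) \<Rightarrow> bool" where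
  "admissible_model \<Omega> s b \<beta> \<longleftrightarrow>
     (\<forall>l\<in>{1..s}. b l \<noteq> 0) \<and> inj_on \<beta> {1..s} \<and> \<beta> ` {1..s} \<subseteq> \<Omega>"

(* The model (s, b, \<beta>) reproduces the data D1, D2 recorded on the two grids
   from the indices N1, N2 on. *)
definition represents_data ::
    "complex set \<Rightarrow> real \<Rightarrow> real \<Rightarrow> real \<Rightarrow> nat \<Rightarrow> nat \<Rightarrow> complex list \<Rightarrow> complex list \<Rightarrow>
     nat \<Rightarrow> (nat \<Rightarrow> complex) \<Rightarrow> (nat \<Rightarrow> complex) \<Rightarrow> bool" where
  "represents_data \<Omega> x0 q1 q2 N1 N2 D1 D2 s b \<beta> \<longleftrightarrow>
     admissible_model \<Omega> s b \<beta> \<and>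
     samples (power_sum s b \<beta>) x0 q1 N1 (length D1) = D1 \<and>
     samples (power_sum s b \<beta>) x0 q2 N2 (length D2) = D2"

definition minimal_order ::
    "real \<Rightarrow> real \<Rightarrow> real \<Rightarrow> nat \<Rightarrow> nat \<Rightarrow> complex list \<Rightarrow> complex list \<Rightarrow> nat" where
  "minimal_order x0 q1 q2 N1 N2 D1 D2 =
     (LEAST s. \<exists>b \<beta>. represents_data UNIV x0 q1 q2 N1 N2 D1 D2 s b \<beta>)"

end

theory Submission
  imports Defs "HOL-Computational_Algebra.Polynomial"
begin

text \<open>
  On a geometric grid a generalized power sum becomes an exponential sum: its value at
  \<open>x0 * q ^ n\<close> is \<open>\<Sum>l. w\<^sub>l * \<rho>\<^sub>l ^ n\<close> with effective weights \<open>w\<^sub>l\<close> that do not depend on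
  \<open>q\<close> and nodes \<open>\<rho>\<^sub>l\<close> that do. The proof compares the given sum with an arbitrary competing
  model of order at most \<open>r\<close>, separately on each grid and then across the two grids.

  On one grid, the two exponential sums together have at most \<open>2 * r\<close> different nodes and agree at
  \<open>2 * r\<close> consecutive indices. Since the Vandermonde system of distinct nonzero nodes is
  nonsingular, both sums carry the same total weight at every node
  (\<open>fiber_weights_eq_if_moments_eq\<close>). The true nodes are distinct with nonzero weights, so every
  true node must also occur in the competitor. Counting then excludes a lower order, and at equal
  order it gives a bijection between the components that preserves nodes and weights
  (\<open>exponential_sum_components_determined\<close>). The competitor may have repeated nodes a priori;
  the counting is what rules them out.

  The two grids yield two bijections, which need not agree a priori. Both preserve the common
  effective weights, so they agree if these are distinct. Under the matching-gap condition they
  agree for another reason: each competing exponent lies in \<open>\<Omega>\<close> and witnesses that the pair of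
  true nodes assigned to it has cost zero, which a false pair cannot have.

  Once the bijections agree, a competing exponent and the true one assigned to it have the same
  node for both scales. A node determines its exponent modulo \<open>2 * pi * \<i> / ln q\<close>, and the two
  lattices of ambiguities meet only in \<open>0\<close> because \<open>ln q1 / ln q2\<close> is irrational
  (\<open>exponent_determined_by_two_nodes\<close>). Equal exponents and equal effective weights give equal
  amplitudes.
\<close>

section \<open>Uniqueness of exponential sums\<close>

text \<open>
  Both sums, weighted by the \<open>N\<close>-th powers of their nodes, agree when tested against every
  polynomial of degree below \<open>M\<close>. Testing with the polynomial that vanishes at all nodes except
  \<open>y\<close> isolates the weight at \<open>y\<close>. This replaces the Vandermonde determinant and allows
  repeated nodes.
\<close>
lemma fiber_weights_eq_if_moments_eq:
  fixes w v \<rho> \<sigma> :: "_ \<Rightarrow> 'a :: field"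
  assumes fin: "finite I" "finite J"
    and card: "card (\<rho> ` I \<union> \<sigma> ` J) \<le> M"
    and nz: "y \<noteq> 0"
    and moments: "\<And>n. n \<in> {N..<N + M} \<Longrightarrow>
      (\<Sum>i\<in>I. w i * \<rho> i ^ n) = (\<Sum>j\<in>J. v j * \<sigma> j ^ n)"
  shows "(\<Sum>i | i \<in> I \<and> \<rho> i = y. w i) = (\<Sum>j | j \<in> J \<and> \<sigma> j = y. v j)"
proof (cases "y \<in> \<rho> ` I \<union> \<sigma> ` J")
  case False
  then have "{i \<in> I. \<rho> i = y} = {}" "{j \<in> J. \<sigma> j = y} = {}"
    by auto
  then show ?thesis
    by (simp only: sum.empty)
next
  case True
  define Z where "Z = \<rho> ` I \<union> \<sigma> ` J"
  define p where "p = (\<Prod>z\<in>Z - {y}. [:- z, 1:])"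
  have finZ: "finite Z"
    using fin by (simp add: Z_def)
  have "degree p \<le> (\<Sum>z\<in>Z - {y}. degree [:- z, 1:])"
    using degree_prod_sum_le[of "Z - {y}" "\<lambda>z. [:- z, 1:]"] finZ by (simp add: p_def o_def)
  also have "\<dots> = card (Z - {y})"
    by simp
  also have "\<dots> < card Z"
    using True finZ by (intro psubset_card_mono) (auto simp: Z_def)
  finally have deg: "degree p < M"
    using card by (simp add: Z_def)
  have p_nz: "poly p y \<noteq> 0"
    using finZ by (auto simp: p_def poly_prod)
  have p_zero: "poly p z = 0" if "z \<in> Z" "z \<noteq> y" for z
    using that finZ by (auto simp: p_def poly_prod)
  have expand: "(\<Sum>i\<in>A. c i * z i ^ N * poly p (z i)) =
      (\<Sum>k\<le>degree p. coeff p k * (\<Sum>i\<in>A. c i * z i ^ (N + k)))"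
    for A and c z :: "'c \<Rightarrow> 'a"
  proof -
    have "(\<Sum>i\<in>A. c i * z i ^ N * poly p (z i)) =
        (\<Sum>i\<in>A. \<Sum>k\<le>degree p. coeff p k * (c i * z i ^ (N + k)))"
      by (simp add: poly_altdef sum_distrib_left power_add mult_ac)
    also have "\<dots> = (\<Sum>k\<le>degree p. coeff p k * (\<Sum>i\<in>A. c i * z i ^ (N + k)))"
      by (subst sum.swap) (simp add: sum_distrib_left)
    finally show ?thesis .
  qed
  have isolate: "(\<Sum>i\<in>A. c i * z i ^ N * poly p (z i)) =
      (\<Sum>i | i \<in> A \<and> z i = y. c i) * (y ^ N * poly p y)"
    if "finite A" "z ` A \<subseteq> Z" for A and c z :: "'c \<Rightarrow> 'a"
  proof -
    have "(\<Sum>i\<in>A. c i * z i ^ N * poly p (z i)) =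
        (\<Sum>i | i \<in> A \<and> z i = y. c i * z i ^ N * poly p (z i))"
      using that p_zero by (intro sum.mono_neutral_right) auto
    also have "\<dots> = (\<Sum>i | i \<in> A \<and> z i = y. c i) * (y ^ N * poly p y)"
      unfolding sum_distrib_right by (intro sum.cong) (auto simp: mult.assoc)
    finally show ?thesis .
  qed
  have "(\<Sum>i\<in>I. w i * \<rho> i ^ N * poly p (\<rho> i)) = (\<Sum>j\<in>J. v j * \<sigma> j ^ N * poly p (\<sigma> j))"
    unfolding expand using moments deg by (intro sum.cong) auto
  then have "(\<Sum>i | i \<in> I \<and> \<rho> i = y. w i) * (y ^ N * poly p y) =
      (\<Sum>j | j \<in> J \<and> \<sigma> j = y. v j) * (y ^ N * poly p y)"
    using fin isolate[of I \<rho> w] isolate[of J \<sigma> v] by (simp add: Z_def)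
  then show ?thesis
    using nz p_nz by simp
qed

text \<open>
  Uniqueness in Prony's method. The weight of a true node is nonzero, so the competitor must use
  that node too; hence there are at least as many components in \<open>J\<close> as in \<open>I\<close>. With at most as
  many, nothing is left over for repeated or additional nodes.
\<close>
lemma exponential_sum_components_determined:
  fixes w v \<rho> \<sigma> :: "_ \<Rightarrow> 'a :: field"
  assumes fin: "finite I" "finite J"
    and card: "card J \<le> card I"
    and inj: "inj_on \<rho> I"
    and w_nz: "\<And>i. i \<in> I \<Longrightarrow> w i \<noteq> 0"
    and \<rho>_nz: "\<And>i. i \<in> I \<Longrightarrow> \<rho> i \<noteq> 0"
    and moments: "\<And>n. n \<in> {N..<N + 2 * card I} \<Longrightarrow>
      (\<Sum>i\<in>I. w i * \<rho> i ^ n) = (\<Sum>j\<in>J. v j * \<sigma> j ^ n)"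
  shows "\<exists>\<pi>. bij_betw \<pi> J I \<and> (\<forall>j\<in>J. \<sigma> j = \<rho> (\<pi> j) \<and> v j = w (\<pi> j))"
proof -
  have "card (\<rho> ` I \<union> \<sigma> ` J) \<le> card (\<rho> ` I) + card (\<sigma> ` J)"
    by (rule card_Un_le)
  also have "\<dots> \<le> card I + card J"
    using fin by (intro add_mono card_image_le)
  finally have "card (\<rho> ` I \<union> \<sigma> ` J) \<le> 2 * card I"
    using card by simp
  then have fibers: "(\<Sum>i' | i' \<in> I \<and> \<rho> i' = \<rho> i. w i') = (\<Sum>j | j \<in> J \<and> \<sigma> j = \<rho> i. v j)"
    if "i \<in> I" for i
    using fin that \<rho>_nz moments by (intro fiber_weights_eq_if_moments_eq[where N = N]) auto
  have weight: "w i = (\<Sum>j | j \<in> J \<and> \<sigma> j = \<rho> i. v j)" if "i \<in> I" for i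
  proof -
    have "{i' \<in> I. \<rho> i' = \<rho> i} = {i}"
      using inj that by (auto dest: inj_onD)
    then show ?thesis
      using fibers[OF that] by simp
  qed
  have sub: "\<rho> ` I \<subseteq> \<sigma> ` J"
  proof
    fix y assume "y \<in> \<rho> ` I"
    then obtain i where i: "i \<in> I" "y = \<rho> i"
      by blast
    have "{j \<in> J. \<sigma> j = \<rho> i} \<noteq> {}"
      using weight[OF i(1)] w_nz[OF i(1)] by (metis sum.empty)
    then show "y \<in> \<sigma> ` J"
      using i by force
  qed
  have card_\<rho>: "card (\<rho> ` I) = card I"
    using inj by (rule card_image)
  have le: "card (\<rho> ` I) \<le> card (\<sigma> ` J)" "card (\<sigma> ` J) \<le> card J"
    using sub fin by (auto intro: card_mono card_image_le)
  have img: "\<rho> ` I = \<sigma> ` J"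
    using sub fin le card card_\<rho> by (intro card_subset_eq) auto
  have inj\<sigma>: "inj_on \<sigma> J"
    using fin le card card_\<rho> by (intro eq_card_imp_inj_on) auto
  define \<pi> where "\<pi> = inv_into I \<rho> \<circ> \<sigma>"
  have "bij_betw \<sigma> J (\<rho> ` I)"
    using inj\<sigma> img by (simp add: bij_betw_def)
  moreover have "bij_betw (inv_into I \<rho>) (\<rho> ` I) I"
    using inj by (intro bij_betw_inv_into inj_on_imp_bij_betw)
  ultimately have bij: "bij_betw \<pi> J I"
    unfolding \<pi>_def by (rule bij_betw_trans)
  have nodes: "\<sigma> j = \<rho> (\<pi> j)" if "j \<in> J" for j
    using that img by (auto simp: \<pi>_def f_inv_into_f)
  have "v j = w (\<pi> j)" if "j \<in> J" for j
  proof -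
    have "{j' \<in> J. \<sigma> j' = \<rho> (\<pi> j)} = {j}"
      using inj\<sigma> that nodes[OF that, symmetric] by (auto dest: inj_onD)
    then show ?thesis
      using weight[of "\<pi> j"] bij that by (auto simp: bij_betw_def)
  qed
  with bij nodes show ?thesis
    by blast
qed

section \<open>Power sums on geometric grids\<close>

lemma power_sum_geometric_grid:
  assumes "x0 > 0" "q > 0"
  shows "power_sum s b \<beta> (x0 * q ^ n) =
    (\<Sum>l\<in>{1..s}. effective_weight b \<beta> x0 l * node \<beta> q l ^ n)"
proof -
  have "of_real (x0 * q ^ n) powr z = of_real x0 powr z * (of_real q powr z) ^ n" for z :: complex
  proof -
    have "ln (x0 * q ^ n) = ln x0 + real n * ln q"
      using assms by (simp add: ln_mult ln_realpow)
    then have "of_real (x0 * q ^ n) powr z = exp (z * of_real (ln x0 + real n * ln q))"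
      using assms by (simp add: powr_def Ln_of_real flip: of_real_mult of_real_power)
    also have "\<dots> = of_real x0 powr z * (of_real q powr z) ^ n"
      using assms by (simp add: powr_def Ln_of_real algebra_simps exp_add flip: exp_of_nat_mult)
    finally show ?thesis .
  qed
  then show ?thesis
    by (simp add: power_sum_def effective_weight_def node_def mult.assoc)
qed

lemma samples_eq_iff:
  "samples f x0 q N m = samples g x0 q N m \<longleftrightarrow> (\<forall>n\<in>{N..<N + m}. f (x0 * q ^ n) = g (x0 * q ^ n))"
  by (auto simp: samples_def)

lemma node_eq_exp: "q > 0 \<Longrightarrow> node \<alpha> q l = exp (of_real (ln q) * \<alpha> l)"
  by (simp add: node_def powr_def Ln_of_real mult.commute)

text \<open>
  If \<open>exp (h * \<alpha>) = exp (h * \<beta>)\<close> and \<open>\<alpha> \<noteq> \<beta>\<close>, then \<open>h * (\<alpha> - \<beta>)\<close> is a nonzero integer multiple of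
  \<open>2 * pi * \<i>\<close>. If this happened for both values of \<open>h\<close>, then \<open>h1 / h2\<close> would be the quotient of
  the two integers.
\<close>
lemma exponent_determined_by_two_nodes:
  fixes h1 h2 :: real and \<alpha> \<beta> :: complex
  assumes irrational: "h1 / h2 \<notin> \<rat>"
    and "exp (of_real h1 * \<alpha>) = exp (of_real h1 * \<beta>)"
    and "exp (of_real h2 * \<alpha>) = exp (of_real h2 * \<beta>)"
  shows "\<alpha> = \<beta>"
proof (rule ccontr)
  assume neq: "\<alpha> \<noteq> \<beta>"
  obtain m n :: int where
    "of_real h1 * \<alpha> = of_real h1 * \<beta> + (of_int (2 * m) * pi) * \<i>"
    "of_real h2 * \<alpha> = of_real h2 * \<beta> + (of_int (2 * n) * pi) * \<i>"
    using assms(2,3) unfolding exp_eq by metis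
  then have m: "of_real h1 * (\<alpha> - \<beta>) = of_int m * (2 * of_real pi * \<i>)"
    and n: "of_real h2 * (\<alpha> - \<beta>) = of_int n * (2 * of_real pi * \<i>)"
    by (simp_all add: algebra_simps)
  have "h2 \<noteq> 0"
    using irrational by auto
  have "of_real h1 * of_int n * (2 * of_real pi * \<i>) * (\<alpha> - \<beta>)
      = of_real h2 * of_int m * (2 * of_real pi * \<i>) * (\<alpha> - \<beta>)"
    using m n by (metis mult.assoc mult.commute)
  then have "complex_of_real (h1 * of_int n) = complex_of_real (h2 * of_int m)"
    using neq by simp
  then have eq: "h1 * of_int n = h2 * of_int m"
    by (simp only: of_real_eq_iff)
  have "n \<noteq> 0"
    using n neq \<open>h2 \<noteq> 0\<close> by auto
  then have "h1 / h2 = of_int m / of_int n"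
    using eq \<open>h2 \<noteq> 0\<close> by (simp add: field_simps)
  then show False
    using irrational by simp
qed

text \<open>
  The infimum over \<open>\<Omega>\<close> is taken of nonnegative quantities, and the one belonging to \<open>\<beta>\<close> is zero.
\<close>
lemma compat_cost_of_admissible_pair:
  assumes "\<beta> \<in> \<Omega>"
  shows "compat_cost q1 q2 \<Omega> (exp (of_real (ln q1) * \<beta>)) (exp (of_real (ln q2) * \<beta>)) \<le> 0"
  unfolding compat_cost_def
  by (rule cINF_lower2[OF _ assms]) (auto intro!: bdd_belowI[where m = 0])

section \<open>Identification from two grids\<close>

theorem theorem3p5:
  fixes r N1 N2 :: nat and a \<alpha> :: "nat \<Rightarrow> complex"
    and x0 q1 q2 :: real and f :: "real \<Rightarrow> complex"
    and \<Omega> :: "complex set" and D1 D2 :: "complex list"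
  assumes f_def: "\<And>x. x > 0 \<Longrightarrow> f x = power_sum r a \<alpha> x"
    and amp: "\<And>l. l \<in> {1..r} \<Longrightarrow> a l \<noteq> 0"
    and expo: "inj_on \<alpha> {1..r}"
    and x0: "x0 > 0"
    and q1: "q1 \<in> {0<..<1}" and q2: "q2 \<in> {0<..<1}"
    and D1: "D1 = samples f x0 q1 N1 (2 * r)"
    and D2: "D2 = samples f x0 q2 N2 (2 * r)"
    and nodes1: "inj_on (node \<alpha> q1) {1..r}"
    and nodes2: "inj_on (node \<alpha> q2) {1..r}"
    and irrational: "ln q1 / ln q2 \<notin> \<rat>"
    and matching:
      "(inj_on (effective_weight a \<alpha> x0) {1..r} \<and> \<Omega> = UNIV) \<or>
       (\<alpha> ` {1..r} \<subseteq> \<Omega> \<and> matching_gap q1 q2 r \<alpha> \<Omega>)"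
  shows "represents_data \<Omega> x0 q1 q2 N1 N2 D1 D2 r a \<alpha> \<and>
    minimal_order x0 q1 q2 N1 N2 D1 D2 = r \<and>
    (\<forall>b \<beta>. represents_data \<Omega> x0 q1 q2 N1 N2 D1 D2 r b \<beta> \<longrightarrow>
      (\<exists>\<pi>. \<pi> permutes {1..r} \<and> (\<forall>l\<in>{1..r}. b l = a (\<pi> l) \<and> \<beta> l = \<alpha> (\<pi> l))))"
proof -
  have q_pos: "q1 > 0" "q2 > 0"
    using q1 q2 by auto
  have len: "length D1 = 2 * r" "length D2 = 2 * r"
    by (simp_all add: D1 D2 samples_def)
  have grid: "samples f x0 q N m = samples (power_sum r a \<alpha>) x0 q N m" if "q > 0" for q N m
    using x0 that f_def by (simp add: samples_eq_iff)
  have self: "represents_data \<Psi> x0 q1 q2 N1 N2 D1 D2 r a \<alpha>" if "\<alpha> ` {1..r} \<subseteq> \<Psi>" for \<Psi>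
    using that amp expo q_pos len
    by (simp add: represents_data_def admissible_model_def D1 D2 grid)
  have \<alpha>_\<Omega>: "\<alpha> ` {1..r} \<subseteq> \<Omega>"
    using matching by auto
  have match: "\<exists>\<pi>. bij_betw \<pi> {1..s} {1..r} \<and>
      (\<forall>k\<in>{1..s}. node \<beta> q k = node \<alpha> q (\<pi> k) \<and>
        effective_weight b \<beta> x0 k = effective_weight a \<alpha> x0 (\<pi> k))"
    if "q > 0" "inj_on (node \<alpha> q) {1..r}" "s \<le> r"
      and data: "samples (power_sum s b \<beta>) x0 q N (2 * r) = samples f x0 q N (2 * r)"
    for s b \<beta> q N
  proof -
    have moments: "(\<Sum>l\<in>{1..r}. effective_weight a \<alpha> x0 l * node \<alpha> q l ^ n) =
        (\<Sum>k\<in>{1..s}. effective_weight b \<beta> x0 k * node \<beta> q k ^ n)"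
      if "n \<in> {N..<N + 2 * card {1..r}}" for n
      using that data \<open>q > 0\<close> x0
      by (simp only: grid samples_eq_iff power_sum_geometric_grid card_atLeastAtMost diff_Suc_1)
    have w_nz: "effective_weight a \<alpha> x0 l \<noteq> 0" if "l \<in> {1..r}" for l
      using amp[OF that] x0 by (simp add: effective_weight_def)
    have node_nz: "node \<alpha> q l \<noteq> 0" for l
      using \<open>q > 0\<close> by (simp add: node_def)
    have card_le: "card {1..s} \<le> card {1..r}"
      using \<open>s \<le> r\<close> by simp
    show ?thesis
      by (rule exponential_sum_components_determined[OF finite_atLeastAtMost finite_atLeastAtMost
            card_le \<open>inj_on (node \<alpha> q) {1..r}\<close> w_nz node_nz moments])
  qed

  have no_smaller: "r \<le> s" if rep: "represents_data UNIV x0 q1 q2 N1 N2 D1 D2 s b \<beta>" for s b \<beta>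
  proof (rule ccontr)
    assume less: "\<not> r \<le> s"
    have "samples (power_sum s b \<beta>) x0 q1 N1 (2 * r) = samples f x0 q1 N1 (2 * r)"
      using rep by (simp add: represents_data_def len D1[symmetric])
    then obtain \<pi> where "bij_betw \<pi> {1..s} {1..r}"
      using match[OF q_pos(1) nodes1, of s b \<beta> N1] less by force
    then show False
      using less by (auto dest: bij_betw_same_card)
  qed
  have minimal: "minimal_order x0 q1 q2 N1 N2 D1 D2 = r"
    unfolding minimal_order_def
    using self[of UNIV] no_smaller by (intro Least_equality) auto

  have unique: "\<exists>\<pi>. \<pi> permutes {1..r} \<and> (\<forall>l\<in>{1..r}. b l = a (\<pi> l) \<and> \<beta> l = \<alpha> (\<pi> l))"
    if rep: "represents_data \<Omega> x0 q1 q2 N1 N2 D1 D2 r b \<beta>" for b \<beta>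
  proof -
    have data: "samples (power_sum r b \<beta>) x0 q1 N1 (2 * r) = samples f x0 q1 N1 (2 * r)"
      "samples (power_sum r b \<beta>) x0 q2 N2 (2 * r) = samples f x0 q2 N2 (2 * r)"
      using rep by (simp_all add: represents_data_def len D1[symmetric] D2[symmetric])
    obtain \<pi>1 where bij1: "bij_betw \<pi>1 {1..r} {1..r}"
      and node1: "\<And>k. k \<in> {1..r} \<Longrightarrow> node \<beta> q1 k = node \<alpha> q1 (\<pi>1 k)"
      and weight1: "\<And>k. k \<in> {1..r} \<Longrightarrow>
        effective_weight b \<beta> x0 k = effective_weight a \<alpha> x0 (\<pi>1 k)"
      using match[OF q_pos(1) nodes1 order_refl data(1)] by blast
    obtain \<pi>2 where bij2: "bij_betw \<pi>2 {1..r} {1..r}"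
      and node2: "\<And>k. k \<in> {1..r} \<Longrightarrow> node \<beta> q2 k = node \<alpha> q2 (\<pi>2 k)"
      and weight2: "\<And>k. k \<in> {1..r} \<Longrightarrow>
        effective_weight b \<beta> x0 k = effective_weight a \<alpha> x0 (\<pi>2 k)"
      using match[OF q_pos(2) nodes2 order_refl data(2)] by blast
    have agree: "\<pi>1 k = \<pi>2 k" if k: "k \<in> {1..r}" for k
    proof -
      have mem: "\<pi>1 k \<in> {1..r}" "\<pi>2 k \<in> {1..r}"
        by (rule bij_betw_apply[OF bij1 k] bij_betw_apply[OF bij2 k])+
      show ?thesis
        using matching
      proof (elim disjE conjE)
        assume "inj_on (effective_weight a \<alpha> x0) {1..r}"
        then show ?thesis
          using weight1[OF k, symmetric] weight2[OF k] mem by (rule inj_onD[OF _ trans])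
      next
        assume "matching_gap q1 q2 r \<alpha> \<Omega>"
        then obtain \<gamma> where "\<gamma> > 0" and gap: "\<And>k l. k \<in> {1..r} \<Longrightarrow> l \<in> {1..r} \<Longrightarrow> k \<noteq> l \<Longrightarrow>
            \<gamma> \<le> compat_cost q1 q2 \<Omega> (node \<alpha> q1 k) (node \<alpha> q2 l)"
          unfolding matching_gap_def by blast
        have "\<beta> k \<in> \<Omega>"
          using rep k by (auto simp: represents_data_def admissible_model_def)
        then have "compat_cost q1 q2 \<Omega> (node \<beta> q1 k) (node \<beta> q2 k) \<le> 0"
          unfolding node_eq_exp[OF q_pos(1)] node_eq_exp[OF q_pos(2)]
          by (rule compat_cost_of_admissible_pair)
        then have "compat_cost q1 q2 \<Omega> (node \<alpha> q1 (\<pi>1 k)) (node \<alpha> q2 (\<pi>2 k)) \<le> 0"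
          by (simp only: node1[OF k] node2[OF k])
        then show ?thesis
          using gap[OF mem] \<open>\<gamma> > 0\<close> by (meson less_le_not_le order_trans)
      qed
    qed
    have expo_eq: "\<beta> k = \<alpha> (\<pi>1 k)" if k: "k \<in> {1..r}" for k
      using node1[OF k] node2[OF k] unfolding agree[OF k, symmetric]
        node_eq_exp[OF q_pos(1)] node_eq_exp[OF q_pos(2)]
      by (rule exponent_determined_by_two_nodes[OF irrational])
    have amp_eq: "b k = a (\<pi>1 k)" if k: "k \<in> {1..r}" for k
      using weight1[OF k] expo_eq[OF k] x0 by (simp add: effective_weight_def)
    define \<pi> where "\<pi> k = (if k \<in> {1..r} then \<pi>1 k else k)" for k
    have "bij_betw \<pi> {1..r} {1..r}"
      using bij1 by (rule bij_betw_cong[THEN iffD1, rotated]) (simp add: \<pi>_def)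
    then have "\<pi> permutes {1..r}"
      by (rule bij_imp_permutes) (simp only: \<pi>_def if_False)
    then show ?thesis
      using expo_eq amp_eq by (intro exI[of _ \<pi>]) (simp add: \<pi>_def)
  qed
  show ?thesis
    using self[OF \<alpha>_\<Omega>] minimal unique by blast
qed

end
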